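(* For all matroids $M$ and $N$ (on disjoint ground sets), $(M\mathbin{\Box} N)^*=N^*\mathbin{\Box} M^*$, where $^*$ denotes the dual matroid and $\Box$ the free product.
   Context: Matroids are on finite ground sets. For a matroid $M$ on $S$ with rank function $\rho_M$, write $\rho(M)=\rho_M(S)$, $\nu_M(A)=|A|-\rho_M(A)$ (nullity) and $\lambda_M(A)=\rho(M)-\rho_M(A)$ (rank-lack) for $A\subseteq S$. For matroids $M$ on $S$ and $N$ on $T$, with $S\cap T=\emptyset$, the free product $M\mathbin{\Box} N$ is the matroid on the disjoint union $S+T$ whose independent sets are exactly those $A\subseteq S+T$ such that $A\cap S$ is independent in $M$ and $\lambda_M(A\cap S)\geq \nu_N(A\cap T)$ (this family is indeed the family of independent sets of a matroid). Equality is equality of matroids on the same ground set $S+T=T+S$. *)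

theory Defs
  imports Main
begin

record 'a set_system =
  ground :: "'a set"
  indeps :: "'a set set"

definition matroid :: "'a set_system \<Rightarrow> bool" where
  "matroid M \<longleftrightarrow>
     finite (ground M) \<and> indeps M \<subseteq> Pow (ground M) \<and> {} \<in> indeps M \<and>
     (\<forall>A B. B \<in> indeps M \<and> A \<subseteq> B \<longrightarrow> A \<in> indeps M) \<and>
     (\<forall>A B. A \<in> indeps M \<and> B \<in> indeps M \<and> card A < card B
        \<longrightarrow> (\<exists>x \<in> B - A. insert x A \<in> indeps M))"

definition basis :: "'a set_system \<Rightarrow> 'a set \<Rightarrow> bool" where
  "basis M B \<longleftrightarrow> B \<in> indeps M \<and> (\<forall>A \<in> indeps M. B \<subseteq> A \<longrightarrow> A = B)"

definition rank_of :: "'a set_system \<Rightarrow> 'a set \<Rightarrow> nat" where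
  "rank_of M A = Max {card I | I. I \<in> indeps M \<and> I \<subseteq> A}"

definition nullity :: "'a set_system \<Rightarrow> 'a set \<Rightarrow> int" where
  "nullity M A = int (card A) - int (rank_of M A)"

definition rank_lack :: "'a set_system \<Rightarrow> 'a set \<Rightarrow> int" where
  "rank_lack M A = int (rank_of M (ground M)) - int (rank_of M A)"

(* The bases of the dual are the complements of the bases. *)
definition dual :: "'a set_system \<Rightarrow> 'a set_system" where
  "dual M = \<lparr>ground = ground M,
             indeps = {A. \<exists>B. basis M B \<and> A \<subseteq> ground M - B}\<rparr>"

(* Meaningful only when the ground sets are disjoint. *)
definition free_product :: "'a set_system \<Rightarrow> 'a set_system \<Rightarrow> 'a set_system" (infixl "\<box>" 70) where
  "M \<box> N = \<lparr>ground = ground M \<union> ground N,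
            indeps = {A. A \<subseteq> ground M \<union> ground N \<and> A \<inter> ground M \<in> indeps M \<and>
                         rank_lack M (A \<inter> ground M) \<ge> nullity N (A \<inter> ground N)}\<rparr>"

lemma matroidD:
  assumes "matroid M"
  shows "finite (ground M)"
    and "A \<in> indeps M \<Longrightarrow> A \<subseteq> ground M"
    and "A \<in> indeps M \<Longrightarrow> finite A"
    and "{} \<in> indeps M"
    and "B \<in> indeps M \<Longrightarrow> A \<subseteq> B \<Longrightarrow> A \<in> indeps M"
    and "A \<in> indeps M \<Longrightarrow> B \<in> indeps M \<Longrightarrow> card A < card B
           \<Longrightarrow> \<exists>x \<in> B - A. insert x A \<in> indeps M"
  using assms unfolding matroid_def
  by (blast, blast, meson Pow_iff finite_subset subsetD, blast, blast, blast)

lemma finite_indep_cards: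
  assumes "matroid M"
  shows "finite {card I | I. I \<in> indeps M \<and> I \<subseteq> A}"
proof -
  have "finite (indeps M)"
    using assms unfolding matroid_def by (meson finite_Pow_iff finite_subset)
  then show ?thesis by simp
qed

lemma rank_of_ge:
  assumes "matroid M" "I \<in> indeps M" "I \<subseteq> A"
  shows "card I \<le> rank_of M A"
  unfolding rank_of_def using assms by (intro Max_ge finite_indep_cards) auto

lemma rank_of_attained:
  assumes "matroid M"
  obtains I where "I \<in> indeps M" "I \<subseteq> A" "card I = rank_of M A"
proof -
  have "rank_of M A \<in> {card I | I. I \<in> indeps M \<and> I \<subseteq> A}"
    unfolding rank_of_def using matroidD(4)[OF assms]
    by (intro Max_in finite_indep_cards assms) auto
  then show thesis using that by auto
qed

lemma rank_of_indep:
  assumes "matroid M" "A \<in> indeps M"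
  shows "rank_of M A = card A"
proof -
  obtain I where "I \<subseteq> A" "card I = rank_of M A"
    using rank_of_attained[OF assms(1)] by metis
  then have "rank_of M A \<le> card A"
    using card_mono[OF matroidD(3)[OF assms]] by metis
  then show ?thesis using rank_of_ge[OF assms order_refl] by simp
qed

lemma rank_of_mono:
  assumes "matroid M" "A \<subseteq> B"
  shows "rank_of M A \<le> rank_of M B"
proof -
  obtain I where "I \<in> indeps M" "I \<subseteq> A" "card I = rank_of M A"
    using rank_of_attained[OF assms(1)] by metis
  then show ?thesis using rank_of_ge[OF assms(1), of I B] assms(2) by auto
qed

lemma indep_extend:
  assumes M: "matroid M" and "A \<in> indeps M" "B \<in> indeps M" "card A \<le> card B"
  shows "\<exists>C \<in> indeps M. A \<subseteq> C \<and> C \<subseteq> A \<union> B \<and> card C = card B"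
  using assms(2,4)
proof (induction "card B - card A" arbitrary: A)
  case 0
  then show ?case by auto
next
  case (Suc n)
  then obtain x where x: "x \<in> B - A" "insert x A \<in> indeps M"
    using matroidD(6)[OF M _ assms(3), of A] by (metis Suc_neq_Zero diff_is_0_eq not_le)
  have "card (insert x A) = Suc (card A)"
    using x matroidD(3)[OF M] Suc.prems by auto
  then have "\<exists>C \<in> indeps M. insert x A \<subseteq> C \<and> C \<subseteq> insert x A \<union> B \<and> card C = card B"
    using Suc.hyps(2) x by (intro Suc.hyps(1)) auto
  then show ?case using x by blast
qed

lemma basis_iff_card:
  assumes M: "matroid M"
  shows "basis M B \<longleftrightarrow> B \<in> indeps M \<and> card B = rank_of M (ground M)"
proof
  assume B: "basis M B"
  then have Bi: "B \<in> indeps M" by (simp add: basis_def)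
  have le: "card B \<le> rank_of M (ground M)"
    by (rule rank_of_ge[OF M Bi matroidD(2)[OF M Bi]])
  obtain I where I: "I \<in> indeps M" "card I = rank_of M (ground M)"
    using rank_of_attained[OF M] by metis
  then obtain C where "C \<in> indeps M" "B \<subseteq> C" "card C = card I"
    using indep_extend[OF M Bi, of I] le by auto
  then show "B \<in> indeps M \<and> card B = rank_of M (ground M)"
    using B I Bi unfolding basis_def by metis
next
  assume B: "B \<in> indeps M \<and> card B = rank_of M (ground M)"
  have "A = B" if A: "A \<in> indeps M" "B \<subseteq> A" for A
    using rank_of_ge[OF M A(1) matroidD(2)[OF M A(1)]] B A card_seteq[of A B]
      matroidD(3)[OF M A(1)] by auto
  then show "basis M B" using B by (auto simp: basis_def)
qed

lemma matroid_dual: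
  assumes M: "matroid M"
  shows "matroid (dual M)"
proof -
  have aug: "\<exists>y \<in> Y - X. \<exists>C. basis M C \<and> insert y X \<subseteq> ground M - C"
    if B: "basis M B" "Y \<subseteq> ground M - B" and B': "basis M B'" "X \<subseteq> ground M - B'"
      and less: "card X < card Y" for X Y B B'
  proof -
    have fin: "finite X" "finite Y" "finite B"
      using B B' matroidD(1)[OF M] matroidD(3)[OF M] unfolding basis_def
      by (meson finite_Diff finite_subset)+
    have i: "B \<in> indeps M" "B' \<in> indeps M" "card B = card B'"
      using B(1) B'(1) basis_iff_card[OF M] by auto
    have "B - X \<in> indeps M" using matroidD(5)[OF M i(1)] by auto
    moreover have "card (B - X) \<le> card B'"
      using i(3) card_mono[OF fin(3), of "B - X"] by auto
    ultimately obtain C where C: "C \<in> indeps M" "B - X \<subseteq> C" "C \<subseteq> (B - X) \<union> B'" "card C = card B'"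
      using indep_extend[OF M _ i(2), of "B - X"] by blast
    have bC: "basis M C" using C B'(1) basis_iff_card[OF M] by auto
    have CX: "C \<inter> X = {}" using C B'(2) by auto
    have "\<not> Y - X \<subseteq> C"
    proof
      assume "Y - X \<subseteq> C"
      then have "(B - X) \<union> (Y - X) \<subseteq> C" using C by auto
      then have "card ((B - X) \<union> (Y - X)) \<le> card B"
        using C(1,4) i(3) matroidD(3)[OF M] by (metis card_mono)
      moreover have "card ((B - X) \<union> (Y - X)) = card (B - X) + card (Y - X)"
        using B(2) fin by (intro card_Un_disjoint) auto
      moreover have "card B = card (B - X) + card (B \<inter> X)"
        using fin by (metis add.commute card_Int_Diff)
      moreover have "card (B \<inter> X) \<le> card (X - Y)"
        using B(2) fin by (intro card_mono) auto
      moreover have "card (X - Y) < card (Y - X)"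
        using less fin card_Int_Diff[of X Y] card_Int_Diff[of Y X] by (simp add: Int_commute)
      ultimately show False by linarith
    qed
    then obtain y where "y \<in> Y - X" "y \<notin> C" by auto
    then show ?thesis using bC CX B(2) B'(2) by blast
  qed
  have "\<exists>B. basis M B"
    using rank_of_attained[OF M, of "ground M"] basis_iff_card[OF M] by metis
  then have "{} \<in> indeps (dual M)" by (simp add: dual_def)
  moreover have "indeps (dual M) \<subseteq> Pow (ground (dual M))" "finite (ground (dual M))"
    using matroidD(1)[OF M] by (auto simp: dual_def)
  moreover have "A \<in> indeps (dual M)" if "B \<in> indeps (dual M)" "A \<subseteq> B" for A B
    using that unfolding dual_def by auto
  moreover have "\<exists>y \<in> Y - X. insert y X \<in> indeps (dual M)"
    if XY: "X \<in> indeps (dual M)" "Y \<in> indeps (dual M)" "card X < card Y" for X Y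
  proof -
    obtain B B' where "basis M B" "Y \<subseteq> ground M - B" "basis M B'" "X \<subseteq> ground M - B'"
      using XY unfolding dual_def by auto
    from aug[OF this XY(3)] show ?thesis unfolding dual_def by simp
  qed
  ultimately show ?thesis unfolding matroid_def by auto
qed

lemma indeps_free_product_iff:
  assumes M: "matroid M" and N: "matroid N" and disj: "ground M \<inter> ground N = {}"
  shows "A \<in> indeps (M \<box> N) \<longleftrightarrow>
    A \<subseteq> ground M \<union> ground N \<and> A \<inter> ground M \<in> indeps M \<and>
    card A \<le> rank_of M (ground M) + rank_of N (A \<inter> ground N)"
proof -
  have "card A = card (A \<inter> ground M) + card (A \<inter> ground N)" if A: "A \<subseteq> ground M \<union> ground N"
  proof -
    have "A = (A \<inter> ground M) \<union> (A \<inter> ground N)" using A by auto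
    moreover have "(A \<inter> ground M) \<inter> (A \<inter> ground N) = {}" using disj by auto
    ultimately show ?thesis
      using matroidD(1)[OF M] matroidD(1)[OF N] by (metis card_Un_disjoint finite_Int)
  qed
  then show ?thesis
    using rank_of_indep[OF M, of "A \<inter> ground M"]
    by (auto simp: free_product_def rank_lack_def nullity_def)
qed

lemma rank_of_augment:
  assumes N: "matroid N" and less: "rank_of N A < rank_of N B"
  shows "\<exists>y \<in> B - A. rank_of N A < rank_of N (insert y A)"
proof -
  obtain I where I: "I \<in> indeps N" "I \<subseteq> A" "card I = rank_of N A"
    using rank_of_attained[OF N] by metis
  obtain J where J: "J \<in> indeps N" "J \<subseteq> B" "card J = rank_of N B"
    using rank_of_attained[OF N] by metis
  obtain y where y: "y \<in> J - I" "insert y I \<in> indeps N"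
    using matroidD(6)[OF N I(1) J(1)] I J less by auto
  have c: "card (insert y I) = Suc (rank_of N A)"
    using y I matroidD(3)[OF N I(1)] by auto
  have "y \<notin> A"
    using rank_of_ge[OF N y(2), of A] c I by auto
  moreover have "card (insert y I) \<le> rank_of N (insert y A)"
    using I by (intro rank_of_ge[OF N y(2)]) auto
  moreover have "y \<in> B" using y J by auto
  ultimately show ?thesis using c by (intro bexI[of _ y]) auto
qed

lemma matroid_free_product:
  assumes M: "matroid M" and N: "matroid N" and disj: "ground M \<inter> ground N = {}"
  shows "matroid (M \<box> N)"
proof -
  let ?S = "ground M" and ?T = "ground N" and ?r = "rank_of M (ground M)"
  note iff = indeps_free_product_iff[OF M N disj]
  have fin: "finite A" if "A \<subseteq> ?S \<union> ?T" for A
    using that matroidD(1)[OF M] matroidD(1)[OF N] by (meson finite_UnI finite_subset)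
  have down: "A \<in> indeps (M \<box> N)" if B: "B \<in> indeps (M \<box> N)" and AB: "A \<subseteq> B" for A B
  proof -
    have nul: "card X + rank_of N Y \<le> card Y + rank_of N X" if XY: "X \<subseteq> Y" "finite Y" for X Y
    proof -
      obtain J where J: "J \<in> indeps N" "J \<subseteq> Y" "card J = rank_of N Y"
        using rank_of_attained[OF N] by metis
      have "card (J \<inter> X) \<le> rank_of N X"
        using J by (intro rank_of_ge[OF N] matroidD(5)[OF N J(1)]) auto
      moreover have "card (J - X) \<le> card (Y - X)" using J XY by (intro card_mono) auto
      moreover have "card J = card (J \<inter> X) + card (J - X)"
        using card_Int_Diff[OF matroidD(3)[OF N J(1)]] .
      moreover have "card (Y - X) + card X = card Y"
        using XY by (metis add.commute card_Diff_subset card_mono finite_subset le_add_diff_inverse)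
      ultimately show ?thesis using J by linarith
    qed
    have Bi: "B \<subseteq> ?S \<union> ?T" "B \<inter> ?S \<in> indeps M" "card B \<le> ?r + rank_of N (B \<inter> ?T)"
      using B iff by auto
    have split: "card X = card (X \<inter> ?T) + card (X - ?T)" if "X \<subseteq> B" for X
      using card_Int_Diff fin that Bi(1) by (metis order_trans)
    have "card (A - ?T) \<le> card (B - ?T)"
      using fin[OF Bi(1)] AB by (intro card_mono) auto
    moreover have "card (A \<inter> ?T) + rank_of N (B \<inter> ?T) \<le> card (B \<inter> ?T) + rank_of N (A \<inter> ?T)"
      using AB fin[OF Bi(1)] by (intro nul) auto
    ultimately have "card A \<le> ?r + rank_of N (A \<inter> ?T)"
      using split[OF AB] split[OF order_refl] Bi(3) by linarith
    moreover have "A \<inter> ?S \<in> indeps M" using AB by (intro matroidD(5)[OF M Bi(2)]) auto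
    ultimately show ?thesis using iff[of A] AB Bi(1) by auto
  qed
  have aug: "\<exists>x \<in> B - A. insert x A \<in> indeps (M \<box> N)"
    if A: "A \<in> indeps (M \<box> N)" and B: "B \<in> indeps (M \<box> N)" and less: "card A < card B" for A B
  proof -
    have Ai: "A \<subseteq> ?S \<union> ?T" "A \<inter> ?S \<in> indeps M" "card A \<le> ?r + rank_of N (A \<inter> ?T)"
      using A iff by auto
    have Bi: "B \<subseteq> ?S \<union> ?T" "B \<inter> ?S \<in> indeps M" "card B \<le> ?r + rank_of N (B \<inter> ?T)"
      using B iff by auto
    have card_ins: "card (insert x A) \<le> Suc (card A)" for x
      using card_insert_le_m1 by (simp add: card_insert_if fin[OF Ai(1)])
    have addT: "insert y A \<in> indeps (M \<box> N)"
      if y: "y \<in> ?T" "Suc (card A) \<le> ?r + rank_of N (insert y (A \<inter> ?T))" for y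
    proof -
      have "insert y A \<inter> ?S = A \<inter> ?S" "insert y A \<inter> ?T = insert y (A \<inter> ?T)"
        using y(1) disj by auto
      then show ?thesis using iff[of "insert y A"] Ai y card_ins[of y] by auto
    qed
    show ?thesis
    proof (cases "card A = ?r + rank_of N (A \<inter> ?T)")
      case True
      then have "rank_of N (A \<inter> ?T) < rank_of N (B \<inter> ?T)" using less Bi(3) by linarith
      then obtain y where y: "y \<in> B \<inter> ?T - A \<inter> ?T"
          "rank_of N (A \<inter> ?T) < rank_of N (insert y (A \<inter> ?T))"
        using rank_of_augment[OF N] by blast
      then have "insert y A \<in> indeps (M \<box> N)" using True by (intro addT) auto
      then show ?thesis using y(1) by blast
    next
      case False
      then have lt: "Suc (card A) \<le> ?r + rank_of N (A \<inter> ?T)" using Ai(3) by simp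
      show ?thesis
      proof (cases "\<exists>y. y \<in> B \<inter> ?T - A")
        case True
        then obtain y where y: "y \<in> B \<inter> ?T - A" by blast
        have "rank_of N (A \<inter> ?T) \<le> rank_of N (insert y (A \<inter> ?T))"
          by (intro rank_of_mono[OF N]) auto
        then have "insert y A \<in> indeps (M \<box> N)" using lt y by (intro addT) auto
        then show ?thesis using y by blast
      next
        case no_T: False
        have dif: "X - ?T = X \<inter> ?S" if "X \<subseteq> ?S \<union> ?T" for X using that disj by auto
        have "card (B \<inter> ?T) \<le> card (A \<inter> ?T)"
          using no_T fin[OF Ai(1)] by (intro card_mono) auto
        then have "card (A \<inter> ?S) < card (B \<inter> ?S)"
          using less card_Int_Diff[OF fin[OF Ai(1)], of ?T] card_Int_Diff[OF fin[OF Bi(1)], of ?T]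
            dif[OF Ai(1)] dif[OF Bi(1)] by simp
        then obtain x where x: "x \<in> B \<inter> ?S - A \<inter> ?S" "insert x (A \<inter> ?S) \<in> indeps M"
          using matroidD(6)[OF M Ai(2) Bi(2)] by blast
        have "insert x A \<inter> ?S = insert x (A \<inter> ?S)" "insert x A \<inter> ?T = A \<inter> ?T"
          using x(1) disj by auto
        then have "insert x A \<in> indeps (M \<box> N)"
          using iff[of "insert x A"] Ai x lt card_ins[of x] by auto
        then show ?thesis using x(1) by blast
      qed
    qed
  qed
  have "{} \<in> indeps (M \<box> N)" using iff[of "{}"] matroidD(4)[OF M] by simp
  moreover have "indeps (M \<box> N) \<subseteq> Pow (ground (M \<box> N))" "finite (ground (M \<box> N))"
    using matroidD(1)[OF M] matroidD(1)[OF N] by (auto simp: free_product_def)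
  ultimately show ?thesis using down aug unfolding matroid_def by auto
qed

end

(* A matroid is determined by its bases.  A set B is a basis of the free product iff it has the
   right size, meets the first ground set in an independent set and meets the second in a spanning
   set.  Complementation turns bases into bases of the dual and exchanges independent with
   spanning, so this description of the bases is self-dual. *)
theory Submission
  imports Defs
begin

lemma ground_dual [simp]: "ground (dual M) = ground M"
  by (simp add: dual_def)

lemma ground_free_product [simp]: "ground (M \<box> N) = ground M \<union> ground N"
  by (simp add: free_product_def)

lemma matroid_basis_exists:
  assumes "matroid M"
  obtains B where "basis M B"
  using rank_of_attained[OF assms, of "ground M"] basis_iff_card[OF assms] by metis

lemma basis_subset_ground:
  assumes "matroid M" "basis M B"
  shows "B \<subseteq> ground M"
  using assms matroidD(2) unfolding basis_def by blast

text \<open>Augmenting an independent set with elements of any basis brings it up to the rank of the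
  matroid, and an independent set of that size is a basis.\<close>

lemma indep_iff_subset_basis:
  assumes M: "matroid M"
  shows "A \<in> indeps M \<longleftrightarrow> (\<exists>B. basis M B \<and> A \<subseteq> B)"
proof
  assume A: "A \<in> indeps M"
  obtain B where B: "basis M B" using matroid_basis_exists[OF M] .
  then have Bi: "B \<in> indeps M" "card B = rank_of M (ground M)"
    using basis_iff_card[OF M] by auto
  have "card A \<le> card B"
    using rank_of_ge[OF M A matroidD(2)[OF M A]] Bi(2) by simp
  then obtain C where "C \<in> indeps M" "A \<subseteq> C" "card C = card B"
    using indep_extend[OF M A Bi(1)] by blast
  then show "\<exists>B. basis M B \<and> A \<subseteq> B"
    using Bi(2) basis_iff_card[OF M] by metis
next
  assume "\<exists>B. basis M B \<and> A \<subseteq> B"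
  then show "A \<in> indeps M" using matroidD(5)[OF M] unfolding basis_def by blast
qed

text \<open>The independent sets are recovered from the bases as their subsets. Comparing subsets of
  the ground set suffices, since every basis lies in it; this supplies the inclusion that the later
  descriptions of bases assume.\<close>

lemma matroid_eqI:
  fixes M N :: "'a set_system"
  assumes "matroid M" "matroid N" "ground M = ground N"
    and "\<And>B. B \<subseteq> ground M \<Longrightarrow> basis M B \<longleftrightarrow> basis N B"
  shows "M = N"
proof -
  have "basis M B \<longleftrightarrow> basis N B" for B
    using assms basis_subset_ground by metis
  then have "indeps M = indeps N"
    using indep_iff_subset_basis[OF assms(1)] indep_iff_subset_basis[OF assms(2)] by auto
  then show ?thesis using assms(3) by simp
qed

text \<open>Bases are pairwise incomparable and complementation reverses inclusion, so no complement
  of a basis lies properly inside another. The maximal dual independent sets are therefore exactly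
  these complements.\<close>

lemma basis_dual_iff:
  assumes M: "matroid M" and X: "X \<subseteq> ground M"
  shows "basis (dual M) X \<longleftrightarrow> basis M (ground M - X)"
proof
  assume L: "basis (dual M) X"
  then obtain B where B: "basis M B" "X \<subseteq> ground M - B"
    unfolding basis_def[of "dual M"] by (auto simp: dual_def)
  then have "ground M - B \<in> indeps (dual M)" by (auto simp: dual_def)
  then have "X = ground M - B" using L B(2) unfolding basis_def[of "dual M"] by blast
  then have "ground M - X = B" using basis_subset_ground[OF M B(1)] by blast
  then show "basis M (ground M - X)" using B(1) by simp
next
  assume R: "basis M (ground M - X)"
  have "A = X" if A: "A \<in> indeps (dual M)" "X \<subseteq> A" for A
  proof -
    obtain B where B: "basis M B" "A \<subseteq> ground M - B" using A(1) by (auto simp: dual_def)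
    have "B \<subseteq> ground M - X" using B A(2) basis_subset_ground[OF M B(1)] by blast
    then have "B = ground M - X" using B(1) R unfolding basis_def by blast
    then show ?thesis using A(2) B(2) by blast
  qed
  moreover have "X \<in> indeps (dual M)"
    using R X by (auto simp: dual_def intro!: exI[of _ "ground M - X"])
  ultimately show "basis (dual M) X" unfolding basis_def[of "dual M"] by blast
qed

lemma dual_dual:
  fixes M :: "'a set_system"
  assumes M: "matroid M"
  shows "dual (dual M) = M"
proof (rule matroid_eqI)
  show "matroid (dual (dual M))" using M matroid_dual by blast
  fix B assume "B \<subseteq> ground (dual (dual M))"
  then have B: "B \<subseteq> ground M" by simp
  then show "basis (dual (dual M)) B \<longleftrightarrow> basis M B"
    using basis_dual_iff[OF matroid_dual[OF M], of B] basis_dual_iff[OF M, of "ground M - B"]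
    by (simp add: double_diff)
qed (use M in auto)

lemma rank_dual_ground:
  assumes M: "matroid M"
  shows "rank_of (dual M) (ground M) + rank_of M (ground M) = card (ground M)"
proof -
  obtain B where B: "basis M B" using matroid_basis_exists[OF M] .
  have BS: "B \<subseteq> ground M" by (rule basis_subset_ground[OF M B])
  then have "basis (dual M) (ground M - B)"
    using B basis_dual_iff[OF M, of "ground M - B"] by (simp add: double_diff)
  then have "card (ground M - B) = rank_of (dual M) (ground M)"
    using basis_iff_card[OF matroid_dual[OF M]] by simp
  moreover have "card B = rank_of M (ground M)" using B basis_iff_card[OF M] by simp
  moreover have "card (ground M) = card B + card (ground M - B)"
    using BS matroidD(1)[OF M] by (metis card_Int_Diff inf.absorb2)
  ultimately show ?thesis by simp
qed

text \<open>A largest independent subset of a set of full rank has the size of a basis, hence is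
  one.\<close>

lemma spanning_iff_contains_basis:
  assumes M: "matroid M"
  shows "rank_of M X = rank_of M (ground M) \<longleftrightarrow> (\<exists>B. basis M B \<and> B \<subseteq> X)"
proof
  assume "rank_of M X = rank_of M (ground M)"
  then show "\<exists>B. basis M B \<and> B \<subseteq> X"
    using rank_of_attained[OF M, of X] basis_iff_card[OF M] by metis
next
  assume "\<exists>B. basis M B \<and> B \<subseteq> X"
  then obtain B where B: "B \<in> indeps M" "card B = rank_of M (ground M)" "B \<subseteq> X"
    using basis_iff_card[OF M] by auto
  obtain I where I: "I \<in> indeps M" "card I = rank_of M X"
    using rank_of_attained[OF M] by metis
  show "rank_of M X = rank_of M (ground M)"
    using rank_of_ge[OF M B(1,3)] rank_of_ge[OF M I(1) matroidD(2)[OF M I(1)]] B(2) I(2)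
    by simp
qed

text \<open>Within the ground set, a basis lies in \<open>X\<close> iff the complement of
  \<open>X\<close> lies in the complement of that basis.\<close>

lemma indep_dual_iff_spanning:
  assumes M: "matroid M" and X: "X \<subseteq> ground M"
  shows "ground M - X \<in> indeps (dual M) \<longleftrightarrow> rank_of M X = rank_of M (ground M)"
proof -
  have "ground M - X \<subseteq> ground M - B \<longleftrightarrow> B \<subseteq> X" if "basis M B" for B
    using basis_subset_ground[OF M that] X by blast
  then show ?thesis unfolding spanning_iff_contains_basis[OF M] by (auto simp: dual_def)
qed

text \<open>This is the preceding equivalence for \<open>dual M\<close> and the complement of
  \<open>X\<close>, read through \<open>dual_dual\<close>.\<close>

lemma spanning_dual_iff_indep:
  assumes M: "matroid M" and X: "X \<subseteq> ground M"
  shows "rank_of (dual M) (ground M - X) = rank_of (dual M) (ground M) \<longleftrightarrow> X \<in> indeps M"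
  using indep_dual_iff_spanning[OF matroid_dual[OF M], of "ground M - X"] X
  by (simp add: dual_dual[OF M] double_diff)

text \<open>The rank of the product is the sum of the two ranks. At that size the bound on
  \<open>card B\<close> in \<open>indeps_free_product_iff\<close> has no slack, so it forces
  \<open>B \<inter> ground N\<close> to have full rank in \<open>N\<close>.\<close>

lemma basis_free_product_iff:
  assumes M: "matroid M" and N: "matroid N" and disj: "ground M \<inter> ground N = {}"
    and B: "B \<subseteq> ground M \<union> ground N"
  shows "basis (M \<box> N) B \<longleftrightarrow>
    B \<inter> ground M \<in> indeps M \<and> rank_of N (B \<inter> ground N) = rank_of N (ground N) \<and>
    card B = rank_of M (ground M) + rank_of N (ground N)"
proof -
  let ?S = "ground M" and ?T = "ground N"
  let ?r = "rank_of M ?S + rank_of N ?T"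
  note P = matroid_free_product[OF M N disj]
  note iff = indeps_free_product_iff[OF M N disj]
  have le: "rank_of N (A \<inter> ?T) \<le> rank_of N ?T" for A
    by (rule rank_of_mono[OF N]) auto
  \<comment> \<open>The union of a basis of \<open>M\<close> and a basis of \<open>N\<close> is
    independent in the product, which gives the lower bound \<open>?r\<close> on its rank.\<close>
  obtain I where "basis M I" using matroid_basis_exists[OF M] .
  then have I: "I \<in> indeps M" "card I = rank_of M ?S" "I \<subseteq> ?S"
    using basis_iff_card[OF M] matroidD(2)[OF M] by auto
  obtain J where "basis N J" using matroid_basis_exists[OF N] .
  then have J: "J \<in> indeps N" "card J = rank_of N ?T" "J \<subseteq> ?T"
    using basis_iff_card[OF N] matroidD(2)[OF N] by auto
  have IJ: "(I \<union> J) \<inter> ?S = I" "(I \<union> J) \<inter> ?T = J" "I \<inter> J = {}" using I J disj by auto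
  have cIJ: "card (I \<union> J) = ?r"
    using IJ(3) I(1,2) J(1,2) matroidD(3)[OF M] matroidD(3)[OF N] by (simp add: card_Un_disjoint)
  have "I \<union> J \<in> indeps (M \<box> N)"
    using iff[of "I \<union> J"] IJ cIJ I J rank_of_indep[OF N J(1)] by auto
  then have "?r \<le> rank_of (M \<box> N) (?S \<union> ?T)"
    using rank_of_ge[OF P, of "I \<union> J" "?S \<union> ?T"] cIJ I(3) J(3) by auto
  \<comment> \<open>For the upper bound, the size condition on an independent \<open>K\<close> is
    weakest when \<open>K \<inter> ?T\<close> has full rank in \<open>N\<close>.\<close>
  moreover obtain K where "K \<in> indeps (M \<box> N)" "card K = rank_of (M \<box> N) (?S \<union> ?T)"
    using rank_of_attained[OF P] by metis
  then have "rank_of (M \<box> N) (?S \<union> ?T) \<le> ?r" using iff[of K] le[of K] by simp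
  ultimately have "rank_of (M \<box> N) (?S \<union> ?T) = ?r" by simp
  then show ?thesis using basis_iff_card[OF P, of B] iff[of B] B le[of B] by auto
qed

theorem proposition4:
  fixes M N :: "'a set_system"
  assumes "matroid M" and "matroid N" and "ground M \<inter> ground N = {}"
  shows "dual (M \<box> N) = dual N \<box> dual M"
proof (rule matroid_eqI)
  note M = assms(1) and N = assms(2) and disj = assms(3)
  let ?S = "ground M" and ?T = "ground N"
  have disj': "ground (dual N) \<inter> ground (dual M) = {}" using disj by auto
  note P = matroid_free_product[OF M N disj]
  show "matroid (dual (M \<box> N))" by (rule matroid_dual[OF P])
  show "matroid (dual N \<box> dual M)"
    by (rule matroid_free_product[OF matroid_dual[OF N] matroid_dual[OF M] disj'])
  show "ground (dual (M \<box> N)) = ground (dual N \<box> dual M)" by auto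
  fix X assume "X \<subseteq> ground (dual (M \<box> N))"
  then have X: "X \<subseteq> ?S \<union> ?T" by simp
  define B where "B = (?S \<union> ?T) - X"
  have XS: "X \<inter> ?S = ?S - B \<inter> ?S" and XT: "X \<inter> ?T = ?T - B \<inter> ?T"
    using X by (auto simp: B_def)
  have "finite (?S \<union> ?T)" using matroidD(1)[OF M] matroidD(1)[OF N] by simp
  then have "card X + card B = card (?S \<union> ?T)"
    unfolding B_def using X by (metis card_Int_Diff inf.absorb2)
  moreover have "card (?S \<union> ?T) = card ?S + card ?T"
    using matroidD(1)[OF M] matroidD(1)[OF N] disj by (rule card_Un_disjoint)
  \<comment> \<open>All four ranks add up to \<open>card ?S + card ?T\<close>, which is also the sum
    of the sizes of \<open>X\<close> and \<open>B\<close>.\<close>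
  ultimately have sizes: "card X = rank_of (dual N) ?T + rank_of (dual M) ?S \<longleftrightarrow>
      card B = rank_of M ?S + rank_of N ?T"
    using rank_dual_ground[OF M] rank_dual_ground[OF N] by linarith
  have "basis (dual (M \<box> N)) X \<longleftrightarrow> basis (M \<box> N) B"
    using basis_dual_iff[OF P, of X] X by (simp add: B_def)
  also have "\<dots> \<longleftrightarrow> B \<inter> ?S \<in> indeps M \<and> rank_of N (B \<inter> ?T) = rank_of N ?T \<and>
      card B = rank_of M ?S + rank_of N ?T"
    by (rule basis_free_product_iff[OF M N disj]) (simp add: B_def)
  \<comment> \<open>Independence on \<open>?S\<close> becomes spanning in \<open>dual M\<close>, and
    spanning on \<open>?T\<close> becomes independence in \<open>dual N\<close>. This exchange is
    why the factors appear in reverse order.\<close>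
  also have "\<dots> \<longleftrightarrow> X \<inter> ?T \<in> indeps (dual N) \<and>
      rank_of (dual M) (X \<inter> ?S) = rank_of (dual M) ?S \<and>
      card X = rank_of (dual N) ?T + rank_of (dual M) ?S"
    using indep_dual_iff_spanning[OF N, of "B \<inter> ?T"] spanning_dual_iff_indep[OF M, of "B \<inter> ?S"]
      sizes unfolding XS XT by auto
  also have "\<dots> \<longleftrightarrow> basis (dual N \<box> dual M) X"
    using basis_free_product_iff[OF matroid_dual[OF N] matroid_dual[OF M] disj', of X] X
    by (simp add: Un_commute)
  finally show "basis (dual (M \<box> N)) X \<longleftrightarrow> basis (dual N \<box> dual M) X" .
qed

end
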